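(* Let $\varepsilon>0$ and let $$ f(n)=\left(1-\frac{\log^{1+\varepsilon}n}{\sqrt{n}}\right)^2. $$ Then there is a partition ideal $X$ such that each of the conditions (1) $p(n,X)=0$ and (2) $p(n,X)>p(nf(n))$ holds for infinitely many positive integers $n$.
   Context: A partition of $n$ is a non-increasing sequence of positive integers (parts) summing to $n$; $p(m)$ is the number of partitions of $m$. A partition $\lambda$ is a subpartition of $\gamma$ if no part occurs more times in $\lambda$ than in $\gamma$. A set $X$ of partitions is a partition ideal if whenever $\gamma\in X$ and $\lambda$ is a subpartition of $\gamma$, then $\lambda\in X$. $p(n,X)$ is the number of partitions of $n$ lying in $X$. (In the paper, $\varepsilon$ is introduced as lying in $(0,1)$ when $f$ is defined.) *)

theory Defs
  imports Complex_Main
begin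

definition is_partition :: "nat list \<Rightarrow> bool" where
  "is_partition \<gamma> \<longleftrightarrow> sorted_wrt (\<ge>) \<gamma> \<and> (\<forall>k \<in> set \<gamma>. 0 < k)"

definition partitions_of :: "nat \<Rightarrow> nat list set" where
  "partitions_of n = {\<gamma>. is_partition \<gamma> \<and> sum_list \<gamma> = n}"

definition subpartition :: "nat list \<Rightarrow> nat list \<Rightarrow> bool" where
  "subpartition \<mu> \<gamma> \<longleftrightarrow> (\<forall>k. count_list \<mu> k \<le> count_list \<gamma> k)"

definition partition_ideal :: "nat list set \<Rightarrow> bool" where
  "partition_ideal X \<longleftrightarrow>
     X \<subseteq> Collect is_partition \<and>
     (\<forall>\<gamma> \<in> X. \<forall>\<mu>. is_partition \<mu> \<and> subpartition \<mu> \<gamma> \<longrightarrow> \<mu> \<in> X)"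

definition num_partitions :: "nat \<Rightarrow> nat" where
  "num_partitions n = card (partitions_of n)"

definition num_partitions_in :: "nat \<Rightarrow> nat list set \<Rightarrow> nat" where
  "num_partitions_in n X = card (partitions_of n \<inter> X)"

(* The partition function at a non-negative real argument is read as p of the integer part. *)
definition num_partitions_real :: "real \<Rightarrow> nat" where
  "num_partitions_real x = num_partitions (nat \<lfloor>x\<rfloor>)"

definition f_eps :: "real \<Rightarrow> nat \<Rightarrow> real" where
  "f_eps \<epsilon> n = (1 - (ln (real n) powr (1 + \<epsilon>)) / sqrt (real n))\<^sup>2"

(* The cardinalities above are those of finite sets. *)
lemma finite_partitions_of: "finite (partitions_of n)"
proof (rule finite_subset)
  have "length \<gamma> \<le> sum_list \<gamma>" if "\<forall>k \<in> set \<gamma>. 0 < k" for \<gamma> :: "nat list"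
    using that by (induction \<gamma>) auto
  then show "partitions_of n \<subseteq> {\<gamma>. set \<gamma> \<subseteq> {..n} \<and> length \<gamma> \<le> n}"
    by (auto simp: partitions_of_def is_partition_def intro: member_le_sum_list)
  show "finite {\<gamma> :: nat list. set \<gamma> \<subseteq> {..n} \<and> length \<gamma> \<le> n}"
    by (rule finite_lists_length_le) simp
qed

end

theory Submission
  imports Defs "HOL-Library.Multiset" "HOL-Library.FuncSet" "HOL-Real_Asymp.Real_Asymp"
begin

text \<open>
  Fix m. Splitting off the parts at most m bounds p(n) by a polynomial in n times the number of
  partitions of some j \<le> n into parts exceeding m. If that number were at most p(j f(j)) for
  all large j, then, since the square root of j f(j) is sqrt j - log^(1+eps) j, the factor
  exp (log^(1+eps) j / 2) gained would absorb the polynomial and induction would give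
  p(n) \<le> A exp (sqrt n / 2), contradicting p((k+1)^2) \<ge> 2^k. So partitions into parts exceeding m
  outnumber p(n f(n)) for infinitely many n. Choosing such n = a(k+1) successively with m = a(k) + 1,
  the partitions of size at most a(k+1) with all parts exceeding a(k) + 1, for any k, form an ideal
  that contains no partition of any a(j) + 1.
\<close>

section \<open>Counting partitions by their parts exceeding a bound m\<close>

lemma is_partition_eqI:
  assumes "is_partition \<gamma>" "is_partition \<mu>" "\<And>k. count_list \<gamma> k = count_list \<mu> k"
  shows "\<gamma> = \<mu>"
proof -
  have "mset (rev \<gamma>) = mset (rev \<mu>)"
    using assms(3) by (intro multiset_eqI) (simp add: count_mset)
  moreover have "sorted (rev \<gamma>)" "sorted (rev \<mu>)"
    using assms(1,2) by (simp_all add: is_partition_def sorted_wrt_rev)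
  ultimately have "rev \<gamma> = rev \<mu>"
    by (metis properties_for_sort)
  then show ?thesis by simp
qed

definition large_partitions :: "nat \<Rightarrow> nat \<Rightarrow> nat list set" where
  "large_partitions m n = {\<gamma> \<in> partitions_of n. \<forall>k \<in> set \<gamma>. m < k}"

lemma finite_large_partitions: "finite (large_partitions m n)"
  by (rule finite_subset[OF _ finite_partitions_of]) (auto simp: large_partitions_def)

lemma card_large_partitions_le: "card (large_partitions m n) \<le> num_partitions n"
  unfolding num_partitions_def
  by (rule card_mono[OF finite_partitions_of]) (auto simp: large_partitions_def)

lemma sum_list_filter_le: "sum_list (filter P xs) \<le> sum_list (xs :: nat list)"
  by (induction xs) auto

lemma count_list_filter: "count_list (filter P xs) x = (if P x then count_list xs x else 0)"
  by (induction xs) auto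

lemma count_list_le_sum_list: "0 < k \<Longrightarrow> count_list \<gamma> k \<le> sum_list (\<gamma> :: nat list)"
  by (induction \<gamma>) auto

text \<open>A partition of n is determined by the multiplicities of 1, ..., m, each between 0 and n,
  and by the list of its parts exceeding m, which is a partition of some j \<le> n.\<close>

lemma num_partitions_le_large:
  "num_partitions n \<le> (n + 1) ^ m * (\<Sum>j\<le>n. card (large_partitions m j))"
proof -
  define F where "F = (\<lambda>\<gamma>. (restrict (count_list \<gamma>) {1..m}, filter (\<lambda>k. m < k) \<gamma>))"
  let ?T = "(\<Pi>\<^sub>E i\<in>{1..m}. {..n}) \<times> (\<Union>j\<in>{..n}. large_partitions m j)"
  have "inj_on F (partitions_of n)"
  proof (rule inj_onI)
    fix \<gamma> \<mu> assume \<gamma>: "\<gamma> \<in> partitions_of n" and \<mu>: "\<mu> \<in> partitions_of n" and F: "F \<gamma> = F \<mu>"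
    show "\<gamma> = \<mu>"
    proof (rule is_partition_eqI)
      show "is_partition \<gamma>" "is_partition \<mu>" using \<gamma> \<mu> by (auto simp: partitions_of_def)
      fix k
      consider "k = 0" | "0 < k" "k \<le> m" | "m < k" by linarith
      then show "count_list \<gamma> k = count_list \<mu> k"
      proof cases
        case 1
        have "0 \<notin> set \<gamma>" "0 \<notin> set \<mu>"
          using \<gamma> \<mu> by (auto simp: partitions_of_def is_partition_def)
        then show ?thesis using 1 by (metis count_list_0_iff)
      next
        case 2
        then show ?thesis using F by (auto simp: F_def restrict_def fun_eq_iff Suc_le_eq split: if_splits)
      next
        case 3
        have "count_list (filter (\<lambda>k. m < k) \<gamma>) k = count_list (filter (\<lambda>k. m < k) \<mu>) k"
          using F unfolding F_def by simp
        then show ?thesis using 3 by (simp add: count_list_filter)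
      qed
    qed
  qed
  moreover have "F ` partitions_of n \<subseteq> ?T"
  proof
    fix z assume "z \<in> F ` partitions_of n"
    then obtain \<gamma> where \<gamma>: "\<gamma> \<in> partitions_of n" and z: "z = F \<gamma>" by auto
    have "filter (\<lambda>k. m < k) \<gamma> \<in> large_partitions m (sum_list (filter (\<lambda>k. m < k) \<gamma>))"
      using \<gamma> by (auto simp: large_partitions_def partitions_of_def is_partition_def sorted_wrt_filter)
    moreover have "sum_list (filter (\<lambda>k. m < k) \<gamma>) \<le> n"
      using \<gamma> sum_list_filter_le[of _ \<gamma>] by (auto simp: partitions_of_def)
    moreover have "restrict (count_list \<gamma>) {1..m} \<in> (\<Pi>\<^sub>E i\<in>{1..m}. {..n})"
      using \<gamma> count_list_le_sum_list[of _ \<gamma>] by (auto simp: partitions_of_def)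
    ultimately show "z \<in> ?T" unfolding z F_def by auto
  qed
  moreover have "finite ?T"
    by (intro finite_cartesian_product finite_PiE finite_UN_I) (auto simp: finite_large_partitions)
  ultimately have "card (partitions_of n) \<le> card ?T"
    by (intro card_inj_on_le)
  also have "\<dots> = (n + 1) ^ m * card (\<Union>j\<in>{..n}. large_partitions m j)"
    by (simp add: card_cartesian_product card_PiE)
  also have "\<dots> \<le> (n + 1) ^ m * (\<Sum>j\<le>n. card (large_partitions m j))"
    by (intro mult_left_mono card_UN_le) auto
  finally show ?thesis by (simp add: num_partitions_def)
qed

section \<open>Growth of the partition function\<close>

lemma num_partitions_square_ge: "2 ^ k \<le> num_partitions ((k + 1)\<^sup>2)"
proof -
  define n where "n = (k + 1)\<^sup>2"
  \<comment> \<open>The elements of a subset S of {2..k+1} are taken as distinct parts, and ones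
    fill up the sum. Since 1 is not in S, the parts at least 2 give S back, so the 2^k subsets yield
    different partitions.\<close>
  define G where "G = (\<lambda>S. rev (sorted_list_of_set S) @ replicate (n - \<Sum>S) (1::nat))"
  have sum_le: "\<Sum>S \<le> n" if "S \<subseteq> {2..k + 1}" for S
  proof -
    have "\<Sum>S \<le> card S * (k + 1)" using that by (intro sum_bounded_above[of S id, simplified]) auto
    also have "\<dots> \<le> k * (k + 1)" using card_mono[OF _ that] by (intro mult_right_mono) auto
    also have "\<dots> \<le> n" by (simp add: n_def power2_eq_square)
    finally show ?thesis .
  qed
  have set_G: "set (G S) \<inter> {2..} = S" if "S \<subseteq> {2..k + 1}" for S
    using that finite_subset[OF that] by (auto simp: G_def)
  have "inj_on G (Pow {2..k + 1})"
    by (rule inj_onI) (metis PowD set_G)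
  moreover have "G ` Pow {2..k + 1} \<subseteq> partitions_of n"
  proof
    fix \<gamma> assume "\<gamma> \<in> G ` Pow {2..k + 1}"
    then obtain S where S: "S \<subseteq> {2..k + 1}" and \<gamma>: "\<gamma> = G S" by auto
    have "finite S" using S finite_subset by blast
    have "sorted (rev \<gamma>)"
      using \<open>finite S\<close> S by (auto simp: \<gamma> G_def sorted_append)
    then have "sorted_wrt (\<ge>) \<gamma>"
      by (simp only: sorted_wrt_rev)
    moreover have "sum_list (sorted_list_of_set S) = \<Sum>S"
      using \<open>finite S\<close> sum_list_distinct_conv_sum_set[of "sorted_list_of_set S" "\<lambda>x. x"] by simp
    ultimately show "\<gamma> \<in> partitions_of n" using \<open>finite S\<close> S sum_le[OF S]
      by (force simp: \<gamma> G_def partitions_of_def is_partition_def sum_list_replicate)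
  qed
  ultimately have "card (Pow {2..k + 1}) \<le> card (partitions_of n)"
    by (rule card_inj_on_le) (rule finite_partitions_of)
  then show ?thesis by (simp add: card_Pow num_partitions_def n_def)
qed

lemma infinite_large_partitions_gt:
  fixes \<epsilon> :: real
  assumes "\<epsilon> > 0"
  shows "\<exists>n>N. card (large_partitions m n) > num_partitions_real (real n * f_eps \<epsilon> n)"
proof (rule ccontr)
  assume "\<not> ?thesis"
  then have large_le: "card (large_partitions m n) \<le> num_partitions_real (real n * f_eps \<epsilon> n)"
    if "n > N" for n using that by (meson not_le)
  define L where "L = (\<lambda>x::real. ln x powr (1 + \<epsilon>))"
  \<comment> \<open>The upper bound makes sqrt n - L n the square root of n f(n), not its negative;
    positivity makes this root smaller than sqrt n.\<close>
  have "eventually (\<lambda>n. 0 < L (real n) \<and> L (real n) \<le> sqrt (real n)) sequentially"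
  proof (rule eventually_conj)
    show "eventually (\<lambda>n. 0 < L (real n)) sequentially"
      unfolding L_def using assms by real_asymp
    show "eventually (\<lambda>n. L (real n) \<le> sqrt (real n)) sequentially"
      unfolding L_def using assms by real_asymp
  qed
  then obtain N1 where L_bounds: "0 < L (real n)" "L (real n) \<le> sqrt (real n)" if "n \<ge> N1" for n
    by (auto simp: eventually_sequentially)
  \<comment> \<open>The exponent is m + 1 rather than m because a further factor n + 1 pays for the
    number of summands j \<le> n. The two bounds that follow serve j < n/4 and j \<ge> n/4
    respectively.\<close>
  have pow_eq: "real (n + 1) ^ (m + 1) = exp (real (m + 1) * ln (real (n + 1)))" for n
    by (simp add: exp_of_nat_mult del: of_nat_Suc of_nat_add of_nat_1)
  have "eventually (\<lambda>n. real (m + 1) * ln (real (n + 1)) \<le> sqrt (real n) / 4) sequentially"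
    by real_asymp
  then have "eventually (\<lambda>n. real (n + 1) ^ (m + 1) \<le> exp (sqrt (real n) / 4)) sequentially"
    by (simp only: pow_eq exp_le_cancel_iff)
  moreover
  have "eventually (\<lambda>n. real (m + 1) * ln (real (n + 1)) \<le> L (real n / 4) / 2) sequentially"
    unfolding L_def using assms by real_asymp
  then have "eventually (\<lambda>n. real (n + 1) ^ (m + 1) \<le> exp (L (real n / 4) / 2)) sequentially"
    by (simp only: pow_eq exp_le_cancel_iff)
  ultimately have "eventually (\<lambda>n. real (n + 1) ^ (m + 1) \<le> exp (sqrt (real n) / 4) \<and>
      real (n + 1) ^ (m + 1) \<le> exp (L (real n / 4) / 2)) sequentially"
    by (rule eventually_conj)
  then obtain N2 where
    pow_le: "real (n + 1) ^ (m + 1) \<le> exp (sqrt (real n) / 4)"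
      "real (n + 1) ^ (m + 1) \<le> exp (L (real n / 4) / 2)" if "n \<ge> N2" for n
    unfolding eventually_sequentially by blast
  \<comment> \<open>For n > N3 and j \<ge> n/4 this gives j > N and j \<ge> N1; the entry 8 gives
    n/4 > 2, so that ln (n/4) is positive and \<open>L\<close> is monotone from there on.\<close>
  define N3 where "N3 = Max {4 * (N + 1), 4 * N1, N2, 8}"
  have N3: "4 * (N + 1) \<le> N3" "4 * N1 \<le> N3" "N2 \<le> N3" "8 \<le> N3"
    by (auto simp: N3_def)
  define A where "A = (\<Sum>n\<le>N3. real (num_partitions n)) + 1"
  have "A > 0" by (auto simp: A_def intro!: add_nonneg_pos sum_nonneg)
  \<comment> \<open>The choice of \<open>A\<close> settles n \<le> N3. The rate 1/2 lies below ln 2,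
    as the comparison with 2^k at the squares will require.\<close>
  have upper: "real (num_partitions n) \<le> A * exp (sqrt (real n) / 2)" for n
  proof (induction n rule: less_induct)
    case (less n)
    show ?case
    proof (cases "n \<le> N3")
      case True
      have "real (num_partitions n) \<le> (\<Sum>n\<le>N3. real (num_partitions n))"
        using True by (intro member_le_sum) auto
      also have "\<dots> \<le> A * 1" by (simp add: A_def)
      also have "\<dots> \<le> A * exp (sqrt (real n) / 2)"
        using \<open>A > 0\<close> by (intro mult_left_mono) auto
      finally show ?thesis .
    next
      case False
      then have n: "N3 < n" by simp
      define R where "R = real (n + 1) ^ (m + 1)"
      have "R > 0" by (simp add: R_def)
      have small: "R * exp (sqrt (real n) / 4) \<le> exp (sqrt (real n) / 2)"
      proof -
        have "R * exp (sqrt (real n) / 4) \<le> exp (sqrt (real n) / 4) * exp (sqrt (real n) / 4)"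
          unfolding R_def using pow_le(1)[of n] n N3 by (intro mult_right_mono) auto
        then show ?thesis by (simp flip: exp_add)
      qed
      have summand: "R * card (large_partitions m j) \<le> A * exp (sqrt (real n) / 2)"
        if j: "j \<le> n" for j
      proof (cases "4 * j < n")
        \<comment> \<open>Here j may be at most N, but the trivial bound by p(j) suffices: sqrt j
          \<le> sqrt n / 2 leaves a factor exp (sqrt n / 4) to absorb \<open>R\<close>.\<close>
        case True
        have "real (card (large_partitions m j)) \<le> num_partitions j"
          using card_large_partitions_le by simp
        also have "\<dots> \<le> A * exp (sqrt (real j) / 2)" using True by (intro less) auto
        also have "\<dots> \<le> A * exp (sqrt (real n) / 4)"
        proof -
          have "sqrt (real j) \<le> sqrt (real n / 2\<^sup>2)" using True by (intro real_sqrt_le_mono) auto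
          then show ?thesis using \<open>A > 0\<close> by (simp add: real_sqrt_divide)
        qed
        finally have "R * card (large_partitions m j) \<le> R * (A * exp (sqrt (real n) / 4))"
          using \<open>R > 0\<close> by simp
        also have "\<dots> = A * (R * exp (sqrt (real n) / 4))" by simp
        also have "\<dots> \<le> A * exp (sqrt (real n) / 2)" using small \<open>A > 0\<close> by simp
        finally show ?thesis .
      next
        \<comment> \<open>Now the assumed bound applies to j. It lowers the exponent by at least
          L(n/4) / 2, which absorbs \<open>R\<close>.\<close>
        case False
        then have j': "N < j" "N1 \<le> j" "2 < j" "n \<le> 4 * j" using n N3 by auto
        define i where "i = nat \<lfloor>real j * f_eps \<epsilon> j\<rfloor>"
        have sq: "real j * f_eps \<epsilon> j = (sqrt (real j) - L (real j))\<^sup>2"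
        proof -
          have "real j * f_eps \<epsilon> j = (sqrt (real j) * (1 - L (real j) / sqrt (real j)))\<^sup>2"
            by (simp add: f_eps_def L_def power_mult_distrib)
          then show ?thesis using j' by (simp add: right_diff_distrib)
        qed
        have "real i \<le> (sqrt (real j) - L (real j))\<^sup>2"
          unfolding i_def sq by simp
        then have "sqrt (real i) \<le> sqrt (real j) - L (real j)"
          using L_bounds[OF j'(2)] by (intro real_le_lsqrt) auto
        moreover have "L (real n / 4) \<le> L (real j)"
          unfolding L_def using n N3 j' assms by (intro powr_mono2) auto
        moreover have "sqrt (real j) \<le> sqrt (real n)" using j by simp
        ultimately have sqrt_i: "sqrt (real i) / 2 \<le> sqrt (real n) / 2 - L (real n / 4) / 2" by linarith
        \<comment> \<open>Strictness matters when j = n: the induction hypothesis is needed at i <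
          n.\<close>
        have "sqrt (real i) < sqrt (real j)"
          using \<open>sqrt (real i) \<le> sqrt (real j) - L (real j)\<close> L_bounds(1)[OF j'(2)] by linarith
        then have "i < n" using j by simp
        have "real (card (large_partitions m j)) \<le> num_partitions i"
          using large_le[OF j'(1)] by (simp add: num_partitions_real_def i_def)
        also have "\<dots> \<le> A * exp (sqrt (real i) / 2)" by (rule less[OF \<open>i < n\<close>])
        also have "\<dots> \<le> A * exp (sqrt (real n) / 2 - L (real n / 4) / 2)"
          using sqrt_i \<open>A > 0\<close> by simp
        finally have "R * card (large_partitions m j)
            \<le> exp (L (real n / 4) / 2) * (A * exp (sqrt (real n) / 2 - L (real n / 4) / 2))"
          unfolding R_def using pow_le(2)[of n] n N3 by (intro mult_mono) auto
        then show ?thesis by (simp add: exp_diff)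
      qed
      have "real (num_partitions n)
          \<le> real ((n + 1) ^ m * (\<Sum>j\<le>n. card (large_partitions m j)))"
        by (rule of_nat_mono[OF num_partitions_le_large])
      \<comment> \<open>The spare factor n + 1 in \<open>R\<close> cancels against the n + 1
        summands.\<close>
      also have "\<dots> = (\<Sum>j\<le>n. R * card (large_partitions m j)) / (n + 1)"
        by (simp add: R_def sum_distrib_left[symmetric])
      also have "\<dots> \<le> (\<Sum>j\<le>n. A * exp (sqrt (real n) / 2)) / (n + 1)"
        by (intro divide_right_mono sum_mono summand) auto
      also have "\<dots> = A * exp (sqrt (real n) / 2)" by simp
      finally show ?thesis .
    qed
  qed
  \<comment> \<open>At n = (k+1)^2 the upper bound is A r^(k+1), which 2^k overtakes because r^2 = e
    \<le> 3 < 4.\<close>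
  define r :: real where "r = exp (1 / 2)"
  have "r\<^sup>2 < 2\<^sup>2" using exp_le by (simp add: r_def power2_eq_square flip: exp_add)
  then have "r < 2" by (rule power_less_imp_less_base) simp
  then have "1 < 2 / r" by (simp add: r_def)
  then obtain k where "A * r < (2 / r) ^ k" using real_arch_pow by blast
  then have "A * r ^ (k + 1) < 2 ^ k" by (simp add: r_def field_simps)
  moreover have "r ^ (k + 1) = exp (real (k + 1) / 2)"
    unfolding r_def exp_of_nat_mult[symmetric] by simp
  moreover have "(2::real) ^ k \<le> num_partitions ((k + 1)\<^sup>2)"
    using of_nat_mono[OF num_partitions_square_ge[of k], where ?'a = real] by simp
  moreover have "real (num_partitions ((k + 1)\<^sup>2)) \<le> A * exp (real (k + 1) / 2)"
    using upper[of "(k + 1)\<^sup>2"] by (simp only: of_nat_power real_sqrt_abs abs_of_nat)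
  ultimately show False by (metis not_less order_trans)
qed

section \<open>Construction of the partition ideal\<close>

lemma subpartition_set: "subpartition \<mu> \<gamma> \<Longrightarrow> set \<mu> \<subseteq> set \<gamma>"
  by (metis count_list_0_iff le_zero_eq subpartition_def subsetI)

lemma subpartition_sum_list: "subpartition \<mu> \<gamma> \<Longrightarrow> sum_list \<mu> \<le> sum_list \<gamma>"
proof -
  assume "subpartition \<mu> \<gamma>"
  then have "mset \<mu> \<subseteq># mset \<gamma>"
    by (simp add: subpartition_def subseteq_mset_def count_mset)
  then have "sum_mset (mset \<mu>) \<le> sum_mset (mset \<gamma>)"
    by (metis le_add1 mset_subset_eq_exists_conv sum_mset.union)
  then show ?thesis by (simp add: sum_mset_sum_list)
qed

theorem theorem8:
  fixes \<epsilon> :: real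
  assumes "\<epsilon> > 0"
  shows "\<exists>X. partition_ideal X \<and>
           infinite {n :: nat. n > 0 \<and> num_partitions_in n X = 0} \<and>
           infinite {n :: nat. n > 0 \<and>
             num_partitions_in n X > num_partitions_real (real n * f_eps \<epsilon> n)}"
proof -
  define good where
    "good = (\<lambda>m n. card (large_partitions m n) > num_partitions_real (real n * f_eps \<epsilon> n))"
  \<comment> \<open>\<open>True\<close> fills the place of the condition on single values in
    \<open>dependent_nat_choice\<close>; only successive values are related.\<close>
  have "\<exists>a. \<forall>k. True \<and> (a k < a (Suc k) \<and> good (a k + 1) (a (Suc k)))"
    by (rule dependent_nat_choice) (use infinite_large_partitions_gt[OF assms] in \<open>auto simp: good_def\<close>)
  then obtain a :: "nat \<Rightarrow> nat"
    where a: "strict_mono a" and good: "\<And>k. good (a k + 1) (a (Suc k))"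
    by (auto simp: strict_mono_Suc_iff)
  define X where
    "X = {\<gamma>. is_partition \<gamma> \<and> (\<exists>k. sum_list \<gamma> \<le> a (Suc k) \<and> (\<forall>x \<in> set \<gamma>. a k + 1 < x))}"
  \<comment> \<open>Passing to a subpartition keeps the witness k: the sum does not grow, which is
    why \<open>X\<close> bounds it instead of fixing it, and no new part sizes appear.\<close>
  have "partition_ideal X"
    unfolding partition_ideal_def X_def
    using subpartition_set subpartition_sum_list by (fastforce intro: order_trans)
  moreover have "infinite {n. n > 0 \<and> num_partitions_in n X = 0}"
  proof (rule infinite_super)
    \<comment> \<open>A witness k would satisfy a(j) < a(k+1), hence j \<le> k, and every part would
      exceed a(k) + 1 \<ge> a(j) + 1, the whole sum. As the sum is positive, there is at least one
      part.\<close>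
    have "partitions_of (a j + 1) \<inter> X = {}" for j
    proof (rule ccontr)
      assume "partitions_of (a j + 1) \<inter> X \<noteq> {}"
      then obtain \<gamma> k where \<gamma>: "sum_list \<gamma> = a j + 1" "a j + 1 \<le> a (Suc k)"
          and parts: "\<forall>x \<in> set \<gamma>. a k + 1 < x"
        by (auto simp: X_def partitions_of_def)
      from \<gamma>(2) have "a j < a (Suc k)" by simp
      then have "a j \<le> a k" using a by (simp add: strict_mono_less strict_mono_less_eq)
      obtain x where "x \<in> set \<gamma>" using \<gamma>(1) by (cases \<gamma>) auto
      moreover from this have "x \<le> a j + 1" using \<gamma>(1) member_le_sum_list[of x \<gamma>] by simp
      ultimately show False using parts \<open>a j \<le> a k\<close> by fastforce
    qed
    then show "range (\<lambda>j. a j + 1) \<subseteq> {n. n > 0 \<and> num_partitions_in n X = 0}"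
      by (auto simp: num_partitions_in_def)
    show "infinite (range (\<lambda>j. a j + 1))"
      by (auto dest!: finite_imageD simp: inj_on_def strict_mono_eq[OF a])
  qed
  moreover have "infinite {n. n > 0 \<and>
      num_partitions_in n X > num_partitions_real (real n * f_eps \<epsilon> n)}"
  proof (rule infinite_super)
    have "a (Suc k) > 0" for k using strict_monoD[OF a, of k "Suc k"] by simp
    moreover have "num_partitions_in (a (Suc k)) X
        > num_partitions_real (real (a (Suc k)) * f_eps \<epsilon> (a (Suc k)))" for k
    proof -
      have "card (large_partitions (a k + 1) (a (Suc k))) \<le> num_partitions_in (a (Suc k)) X"
        unfolding num_partitions_in_def
        by (intro card_mono finite_Int disjI1 finite_partitions_of)
          (auto simp: large_partitions_def X_def partitions_of_def)
      then show ?thesis using good[of k] by (simp add: good_def)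
    qed
    ultimately show "range (\<lambda>k. a (Suc k)) \<subseteq> {n. n > 0 \<and>
        num_partitions_in n X > num_partitions_real (real n * f_eps \<epsilon> n)}"
      by auto
    show "infinite (range (\<lambda>k. a (Suc k)))"
      by (auto dest!: finite_imageD simp: inj_on_def strict_mono_eq[OF a])
  qed
  ultimately show ?thesis by blast
qed

end
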